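(* Let $\Omega\subsetneq\mathbb{C}$ be a simply connected domain with $1\in\Omega$ which is starlike with respect to $1$ and symmetric with respect to $\mathbb{R}$ (i.e. $\overline{\Omega}=\Omega$, where the bar denotes complex conjugation). Let $\phi_\Omega$ be the unique conformal map of $\mathbb{D}$ onto $\Omega$ with $\phi_\Omega(0)=1$, $\phi_\Omega'(0)>0$, and set \[k_\Omega(z)=\int_0^z\exp\left(\int_0^t\frac{\phi_\Omega(\zeta)-1}{\zeta}\,d\zeta\right)dt,\quad z\in\mathbb{D}.\] Then for each $r\in(0,1)$, $\theta\mapsto\log|k_\Omega'(re^{i\theta})|$ is a symmetric (even) function of $\theta\in[-\pi,\pi]$ and is nonincreasing on $[0,\pi]$. Moreover, for every $f\in\mathcal{C}(\Omega)$, every $r\in(0,1)$, every convex nondecreasing function $\Phi$ on $\mathbb{R}$, every $\theta\in[0,\pi]$ and every Lebesgue measurable set $E\subset[-\pi,\pi]$ of Lebesgue measure $2\theta$, \[\int_E\Phi(\log|f'(re^{is})|)\,ds\le\int_{-\theta}^{\theta}\Phi(\log|k_\Omega'(re^{is})|)\,ds.\] In particular $\int_E r|f'(re^{is})|\,ds\le\int_{-\theta}^{\theta}r|k_\Omega'(re^{is})|\,ds$, i.e. the length of $\{f(re^{is}):s\in E\}$ does not exceed that of $\{k_\Omega(re^{is}):|s|\le\theta\}$.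
   Context: $\mathcal{A}_0$ denotes the set of analytic functions $f$ on $\mathbb{D}$ with $f(0)=0$, $f'(0)=1$. $\mathcal{C}(\Omega)=\{f\in\mathcal{A}_0: 1+zf''(z)/f'(z)\in\Omega \text{ for all } z\in\mathbb{D}\}$. *)

theory Defs
  imports "HOL-Complex_Analysis.Complex_Analysis"
begin

definition A0 :: "(complex \<Rightarrow> complex) set" where
  "A0 = {f. f holomorphic_on ball 0 1 \<and> f 0 = 0 \<and> deriv f 0 = 1}"

text \<open>The class C(Omega). The quotient z f''/f' is required to be defined,
  i.e. f' does not vanish on the disc.\<close>
definition convC :: "complex set \<Rightarrow> (complex \<Rightarrow> complex) set" where
  "convC \<Omega> = {f \<in> A0. \<forall>z \<in> ball 0 1. deriv f z \<noteq> 0 \<and>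
       1 + z * deriv (deriv f) z / deriv f z \<in> \<Omega>}"

definition kfun :: "(complex \<Rightarrow> complex) \<Rightarrow> complex \<Rightarrow> complex" where
  "kfun \<phi> z = contour_integral (linepath 0 z)
      (\<lambda>t. exp (contour_integral (linepath 0 t) (\<lambda>\<zeta>. (\<phi> \<zeta> - 1) / \<zeta>)))"

end

theory Submission
  imports Defs
begin

text \<open>The function \<open>h = \<phi> - 1\<close> is univalent and starlike, and \<open>g z = \<integral>\<^sub>0\<^sup>z h \<zeta> / \<zeta> d\<zeta>\<close> equals \<open>log k'\<close>.
  Since \<open>d/d\<theta> Re g (r e\<^sup>i\<^sup>\<theta>) = - Im h (r e\<^sup>i\<^sup>\<theta>)\<close>, symmetry and monotonicity follow from the reflection
  symmetry of \<open>h\<close>, which maps the upper half disc into the upper half plane. For \<open>f\<close> in the class, \<open>Q = log f'\<close>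
  satisfies \<open>z Q' \<prec> h = z g'\<close>; as \<open>g\<close> is convex univalent, Suffridge's theorem gives \<open>Q = g \<circ> \<omega>\<close> with a Schwarz
  function \<open>\<omega>\<close>. Littlewood subordination, applied to the convex function \<open>max (\<Phi> - t) 0\<close> of the harmonic
  function \<open>Re g\<close>, with \<open>t\<close> the value of \<open>\<Phi> (Re g)\<close> at \<open>r e\<^sup>i\<^sup>\<theta>\<close>, yields the integral inequality.\<close>

section \<open>Primitives, circle means and extrema on discs\<close>

text \<open>Since \<open>h 0 = 0\<close>, the singularity of \<open>h z / z\<close> at 0 is
  removable; \<open>D\<close> takes the value \<open>deriv h 0\<close> there and has a primitive on
  the disc. This one factorisation serves circle means, the construction of \<open>log k'\<close>,
  and Jack's lemma.\<close>

lemma primitive_of_quotient: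
  fixes h :: "complex \<Rightarrow> complex"
  assumes "h holomorphic_on ball 0 \<rho>" "h 0 = 0"
  obtains D P where "D holomorphic_on ball 0 \<rho>" "P 0 = 0"
    "\<And>z. z \<in> ball 0 \<rho> \<Longrightarrow> (P has_field_derivative D z) (at z)"
    "\<And>z. h z = z * D z"
proof -
  define D where "D z = (if z = 0 then deriv h 0 else h z / z)" for z
  have D: "D holomorphic_on ball 0 \<rho>"
    using pole_lemma_open[OF assms(1) open_ball, of 0] unfolding D_def[abs_def] assms(2) diff_zero .
  obtain P where P: "\<And>z. z \<in> ball 0 \<rho> \<Longrightarrow> (P has_field_derivative D z) (at z within ball 0 \<rho>)"
    using holomorphic_convex_primitive'[OF convex_ball open_ball D] by metis
  show thesis
  proof (rule that[of D "\<lambda>z. P z - P 0"])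
    show "((\<lambda>z. P z - P 0) has_field_derivative D z) (at z)" if "z \<in> ball 0 \<rho>" for z
      using DERIV_diff[OF P[OF that] DERIV_const[of "P 0"]] that
      by (simp add: at_within_open[OF that open_ball])
  qed (use D assms(2) in \<open>auto simp: D_def\<close>)
qed

lemma has_vector_derivative_along_circle:
  fixes P :: "complex \<Rightarrow> complex"
  assumes "(P has_field_derivative D) (at (of_real r * exp (\<i> * of_real s)))"
  shows "((\<lambda>s. P (of_real r * exp (\<i> * of_real s))) has_vector_derivative
          \<i> * (of_real r * exp (\<i> * of_real s)) * D) (at s within S)"
proof -
  have "((\<lambda>s. of_real r * exp (\<i> * of_real s)) has_vector_derivative
          \<i> * (of_real r * exp (\<i> * of_real s))) (at s within S)"
    by (rule has_vector_derivative_at_within, rule has_vector_derivative_real_field)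
       (auto intro!: derivative_eq_intros simp: algebra_simps)
  then show ?thesis
    using field_vector_diff_chain_within[where f = "\<lambda>s. of_real r * exp (\<i> * of_real s)" and g = P]
      has_field_derivative_at_within[OF assms]
    by (fastforce simp: o_def)
qed

text \<open>With \<open>F z - F 0 = z * D z\<close> and \<open>P' = D\<close>, the function
  \<open>\<i> * (F - F 0)\<close> on the circle is the angular derivative of \<open>P\<close>, so
  its integral over the closed circle is 0.\<close>

lemma holomorphic_circle_mean:
  fixes F :: "complex \<Rightarrow> complex"
  assumes F: "F holomorphic_on ball 0 \<rho>" and r: "0 \<le> r" "r < \<rho>"
  shows "((\<lambda>s. F (of_real r * exp (\<i> * of_real s))) has_integral (2 * pi * F 0)) {-pi..pi}"
proof -
  have "(\<lambda>z. F z - F 0) holomorphic_on ball 0 \<rho>"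
    by (intro holomorphic_intros F)
  then obtain D P where P: "\<And>z. z \<in> ball 0 \<rho> \<Longrightarrow> (P has_field_derivative D z) (at z)"
      and D: "\<And>z. F z - F 0 = z * D z"
    using primitive_of_quotient by (metis (no_types, lifting) diff_self)
  let ?c = "\<lambda>s::real. of_real r * exp (\<i> * of_real s)"
  have c: "?c s \<in> ball 0 \<rho>" for s
    using r by (simp add: norm_mult)
  have "((\<lambda>s. \<i> * ?c s * D (?c s)) has_integral (P (?c pi) - P (?c (-pi)))) {-pi..pi}"
    by (rule fundamental_theorem_of_calculus)
       (use has_vector_derivative_along_circle[OF P[OF c]] in auto)
  moreover have "?c pi = ?c (-pi)"
    by (simp add: exp_minus exp_Euler)
  ultimately have "((\<lambda>s. \<i> * (F (?c s) - F 0)) has_integral 0) {-pi..pi}"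
    by (simp add: D mult.assoc)
  from has_integral_mult_right[OF this, of "-\<i>"]
  have "((\<lambda>s. F (?c s) - F 0) has_integral 0) {-pi..pi}"
    by (simp add: mult.assoc[symmetric])
  from has_integral_add[OF this has_integral_const_real[of "F 0" "-pi" pi]]
  show ?thesis by (simp add: scaleR_conv_of_real)
qed

text \<open>First-order conditions along the circle through the maximum point and along its radius.\<close>
lemma Re_max_on_disc_derivative:
  assumes G: "(G has_field_derivative G') (at z0)"
    and max: "\<And>z. norm z \<le> norm z0 \<Longrightarrow> Re (G z) \<le> Re (G z0)"
  shows "Im (z0 * G') = 0" "Re (z0 * G') \<ge> 0"
proof -
  have "((\<lambda>s. Re (G (z0 * exp (\<i> * of_real s)))) has_real_derivative Re (\<i> * (z0 * G'))) (at 0)"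
  proof -
    have "((\<lambda>w. z0 * exp (\<i> * w)) has_field_derivative z0 * \<i>) (at (of_real 0))"
      by (auto intro!: derivative_eq_intros)
    from DERIV_chain2[OF _ this, of G G'] G
    have "((\<lambda>w. G (z0 * exp (\<i> * w))) has_field_derivative (\<i> * (z0 * G'))) (at (of_real 0))"
      by (simp add: mult_ac)
    then show ?thesis
      by (rule has_field_derivative_Re[OF has_vector_derivative_real_field])
  qed
  moreover have "\<forall>y. \<bar>0 - y\<bar> < 1 \<longrightarrow> Re (G (z0 * exp (\<i> * of_real y))) \<le> Re (G (z0 * exp (\<i> * of_real 0)))"
    by (auto intro!: max simp: norm_mult)
  ultimately have "Re (\<i> * (z0 * G')) = 0"
    by (intro DERIV_local_max[of _ _ 0 1]) auto
  then show "Im (z0 * G') = 0" by simp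
  have d: "((\<lambda>t. Re (G (z0 * of_real t))) has_real_derivative Re (z0 * G')) (at 1)"
  proof -
    have "((\<lambda>w. z0 * w) has_field_derivative z0) (at (of_real 1))"
      by (auto intro!: derivative_eq_intros)
    from DERIV_chain2[OF _ this, of G G'] G
    have "((\<lambda>w. G (z0 * w)) has_field_derivative (z0 * G')) (at (of_real 1))"
      by (simp add: mult_ac)
    then show ?thesis
      by (rule has_field_derivative_Re[OF has_vector_derivative_real_field])
  qed
  show "Re (z0 * G') \<ge> 0"
  proof (rule ccontr)
    assume "\<not> ?thesis"
    then obtain e where e: "e > 0"
      "\<And>h. 0 < h \<Longrightarrow> h < e \<Longrightarrow> Re (G (z0 * of_real 1)) < Re (G (z0 * of_real (1 - h)))"
      using DERIV_neg_dec_left[OF d] by auto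
    \<comment> \<open>Capping at 1 keeps \<open>1 - k\<close> in [0, 1], so the shifted point stays
      in the disc on which \<open>max\<close> applies.\<close>
    define k where "k = min (e/2) 1"
    have "norm (z0 * of_real (1 - k)) \<le> norm z0"
      using e(1) unfolding norm_mult norm_of_real k_def
      by (intro mult_left_le) (auto simp: min_def)
    then have "Re (G (z0 * of_real (1 - k))) \<le> Re (G z0)" by (rule max)
    moreover have "0 < k" "k < e" using e(1) by (auto simp: k_def min_def)
    ultimately show False using e(2)[of k] by simp
  qed
qed

section \<open>Subordination and starlike univalent functions\<close>

text \<open>Univalence of \<open>h\<close> allows \<sigma> to be the inverse of \<open>h\<close>
  composed with \<open>q\<close>; the last bound is then the Schwarz lemma.\<close>

lemma subordination_Schwarz:
  fixes h q :: "complex \<Rightarrow> complex"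
  assumes h: "h holomorphic_on ball 0 1" "inj_on h (ball 0 1)" "h 0 = 0"
    and q: "q holomorphic_on ball 0 1" "q 0 = 0" "q ` ball 0 1 \<subseteq> h ` ball 0 1"
  obtains \<sigma> where "\<sigma> holomorphic_on ball 0 1" "\<sigma> 0 = 0"
    "\<And>z. norm z < 1 \<Longrightarrow> h (\<sigma> z) = q z" "\<And>z. norm z < 1 \<Longrightarrow> norm (\<sigma> z) < 1"
    "\<And>z. norm z < 1 \<Longrightarrow> norm (\<sigma> z) \<le> norm z"
proof -
  obtain k where k: "k holomorphic_on (h ` ball 0 1)" "\<And>z. z \<in> ball 0 1 \<Longrightarrow> k (h z) = z"
    using holomorphic_has_inverse[OF h(1) open_ball h(2)] by metis
  define \<sigma> where "\<sigma> = k \<circ> q"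
  have hol: "\<sigma> holomorphic_on ball 0 1"
    unfolding \<sigma>_def by (rule holomorphic_on_compose_gen[OF q(1) k(1) q(3)])
  have 0: "\<sigma> 0 = 0" using k(2)[of 0] h(3) q(2) by (simp add: \<sigma>_def)
  have *: "h (\<sigma> z) = q z \<and> norm (\<sigma> z) < 1" if "norm z < 1" for z
  proof -
    from that q(3) obtain w where "w \<in> ball 0 1" "q z = h w" by force
    then show ?thesis using k(2)[of w] by (simp add: \<sigma>_def)
  qed
  show thesis
    by (rule that[OF hol 0]) (use * Schwarz_Lemma(1)[OF hol 0] in auto)
qed

text \<open>Starlikeness is put as a property of the image instead of the sign of Re (z h' / h): in
  this form it says directly that \<open>t * h\<close> is subordinate to \<open>h\<close>.\<close>

definition starlike_univalent :: "(complex \<Rightarrow> complex) \<Rightarrow> bool" where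
  "starlike_univalent h \<longleftrightarrow> h holomorphic_on ball 0 1 \<and> inj_on h (ball 0 1) \<and> h 0 = 0 \<and>
     (\<forall>z t. norm z < 1 \<longrightarrow> 0 \<le> t \<longrightarrow> t \<le> 1 \<longrightarrow> of_real t * h z \<in> h ` ball 0 1)"

text \<open>For fixed \<open>t\<close>, subordination of \<open>t * h\<close> to \<open>h\<close>
  yields a Schwarz function \<sigma> with \<open>w = \<sigma> z\<close>. Equality of moduli makes
  \<sigma> a rotation by some \<alpha>, and comparing derivatives at 0 gives
  \<open>\<alpha> = t\<close>, which is impossible for \<open>t < 1\<close>. Geometrically,
  \<open>h\<close> maps every smaller concentric disc onto a starlike set.\<close>

lemma starlike_univalent_level_le:
  assumes h: "starlike_univalent h" and zw: "norm z < 1" "norm w < 1" "h w = of_real t * h z"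
    and t: "0 \<le> t" "t \<le> 1"
  shows "norm w \<le> norm z" "t < 1 \<Longrightarrow> z \<noteq> 0 \<Longrightarrow> norm w < norm z"
proof -
  have hh: "h holomorphic_on ball 0 1" "inj_on h (ball 0 1)" "h 0 = 0"
    using h by (auto simp: starlike_univalent_def)
  obtain \<sigma> where \<sigma>: "\<sigma> holomorphic_on ball 0 1" "\<sigma> 0 = 0"
    "\<And>z. norm z < 1 \<Longrightarrow> h (\<sigma> z) = of_real t * h z" "\<And>z. norm z < 1 \<Longrightarrow> norm (\<sigma> z) < 1"
    "\<And>z. norm z < 1 \<Longrightarrow> norm (\<sigma> z) \<le> norm z"
  proof (rule subordination_Schwarz[OF hh, of "\<lambda>z. of_real t * h z"])
    show "(\<lambda>z. of_real t * h z) ` ball 0 1 \<subseteq> h ` ball 0 1"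
      using h t by (auto simp: starlike_univalent_def)
  qed (auto intro!: holomorphic_intros hh)
  have w: "w = \<sigma> z"
    using hh(2) zw \<sigma>(3,4)[of z] by (auto simp: inj_on_def)
  show le: "norm w \<le> norm z" using w \<sigma>(5) zw by auto
  assume t1: "t < 1" and z0: "z \<noteq> 0"
  show "norm w < norm z"
  proof (rule ccontr)
    assume "\<not> norm w < norm z"
    with le w have "norm (\<sigma> z) = norm z" by simp
    with zw(1) z0 obtain \<alpha> where \<alpha>: "\<And>z. norm z < 1 \<Longrightarrow> \<sigma> z = \<alpha> * z" "norm \<alpha> = 1"
      using Schwarz_Lemma(3)[OF \<sigma>(1,2,4)] by blast
    have dh: "(h has_field_derivative deriv h 0) (at 0)"
      using hh(1) by (meson holomorphic_derivI open_ball centre_in_ball zero_less_one)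
    have "((\<lambda>z. h (\<alpha> * z)) has_field_derivative deriv h 0 * \<alpha>) (at 0)"
      using DERIV_chain2[of h "deriv h 0" "\<lambda>z. \<alpha> * z" 0 \<alpha> UNIV] dh DERIV_cmult_Id by simp
    moreover have "((\<lambda>z. h (\<alpha> * z)) has_field_derivative of_real t * deriv h 0) (at 0)"
    proof (rule has_field_derivative_transform_within_open[OF DERIV_cmult[OF dh, of "of_real t"] open_ball])
      show "of_real t * h z = h (\<alpha> * z)" if "z \<in> ball 0 1" for z
        using \<sigma>(3)[of z] \<alpha>(1)[of z] that by simp
    qed simp
    ultimately have "deriv h 0 * \<alpha> = of_real t * deriv h 0"
      by (rule DERIV_unique)
    moreover have "deriv h 0 \<noteq> 0"
      using holomorphic_injective_imp_regular[OF hh(1) open_ball hh(2)] by simp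
    ultimately have "\<alpha> = of_real t" by simp
    then show False using \<alpha>(2) t1 t by simp
  qed
qed

text \<open>If \<open>m\<close> differs from 1, the strict inequality for moduli separates
  \<open>norm w\<close> from \<open>norm z\<close>; if \<open>m = 1\<close>, injectivity decides. So
  a ray from 0 meets the image of a circle at most once.\<close>

lemma starlike_univalent_ray:
  assumes h: "starlike_univalent h" and "norm z < 1" "norm w = norm z"
    and m: "h w = of_real m * h z" "0 \<le> m"
  shows "w = z"
proof (cases "z = 0")
  case False
  have inj: "inj_on h (ball 0 1)" "h 0 = 0" using h by (auto simp: starlike_univalent_def)
  consider "m < 1" | "m = 1" | "m > 1" by linarith
  then show ?thesis
  proof cases
    case 1
    then show ?thesis
      using starlike_univalent_level_le(2)[OF h, of z w m] assms False by auto
  next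
    case 2
    then show ?thesis using inj assms by (auto simp: inj_on_def)
  next
    case 3
    then have "h z = of_real (1/m) * h w" using m by (simp add: field_simps)
    then show ?thesis
      using starlike_univalent_level_le(2)[OF h, of w z "1/m"] assms False 3 by fastforce
  qed
qed (use assms in auto)

lemma starlike_univalent_quotient_nonzero:
  assumes h: "starlike_univalent h" and D: "D holomorphic_on ball 0 1" "\<And>z. h z = z * D z"
    and z: "norm z < 1"
  shows "D z \<noteq> 0"
proof (cases "z = 0")
  case True
  have "((\<lambda>z. z * D z) has_field_derivative D 0) (at 0)"
    using DERIV_mult[OF DERIV_ident holomorphic_derivI[OF D(1) open_ball, of 0]] by simp
  then have "deriv h 0 = D 0"
    unfolding D(2)[symmetric] by (rule DERIV_imp_deriv)
  moreover have "deriv h 0 \<noteq> 0"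
    using h holomorphic_injective_imp_regular[of h "ball 0 1" 0]
    by (auto simp: starlike_univalent_def)
  ultimately show ?thesis using True by simp
next
  case False
  then have "h z \<noteq> h 0"
    using h z by (auto simp: starlike_univalent_def inj_on_def)
  then show ?thesis using D(2)[of z] h by (auto simp: starlike_univalent_def)
qed

text \<open>Alexander's theorem: the primitive of \<open>h z / z\<close> is convex. The supporting line of the image of
  the disc of radius \<open>norm z1\<close> at \<open>g z1\<close> has normal \<open>h z1\<close>, because at any maximum point \<open>z\<close> of
  \<open>Re (cnj (h z1) * g)\<close> the first-order conditions put \<open>h z\<close> on the ray through \<open>h z1\<close>.\<close>
lemma starlike_primitive_support:
  assumes h: "starlike_univalent h"
    and D: "D holomorphic_on ball 0 1" "\<And>z. h z = z * D z"
    and g: "\<And>z. norm z < 1 \<Longrightarrow> (g has_field_derivative D z) (at z)"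
    and z: "norm z1 < 1" "norm z \<le> norm z1" "z \<noteq> z1"
  shows "Re (cnj (h z1) * g z) < Re (cnj (h z1) * g z1)"
proof -
  have z1: "z1 \<noteq> 0" using z by auto
  then have hz1: "h z1 \<noteq> 0"
    using D(2) starlike_univalent_quotient_nonzero[OF h D] z(1) by auto
  define G where "G = (\<lambda>z. cnj (h z1) * g z)"
  have G: "(G has_field_derivative cnj (h z1) * D z) (at z)" if "norm z < 1" for z
    unfolding G_def by (intro DERIV_cmult g that)
  have uniq: "m = z1" if m: "norm m \<le> norm z1" "\<And>z. norm z \<le> norm z1 \<Longrightarrow> Re (G z) \<le> Re (G m)" for m
  proof -
    note Gm = G[OF order.strict_trans1[OF m(1) z(1)]]
    have G'0: "cnj (h z1) * D m \<noteq> 0"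
      using hz1 starlike_univalent_quotient_nonzero[OF h D] m(1) z(1) by auto
    have "norm m = norm z1"
    proof (rule ccontr)
      assume "norm m \<noteq> norm z1"
      then have "m \<in> ball 0 (norm z1)" using m(1) by simp
      moreover have "((\<lambda>z. Re (G z)) has_derivative (\<lambda>v. Re (cnj (h z1) * D m * v))) (at m)"
        using Gm by (intro has_derivative_Re) (simp add: has_field_derivative_def)
      ultimately have "(\<lambda>v. Re (cnj (h z1) * D m * v)) = (\<lambda>v. 0)"
        using m(2) by (intro differential_zero_maxmin[of m "ball 0 (norm z1)"]) auto
      \<comment> \<open>At an interior maximum the real differential of \<open>Re G\<close>
        vanishes; in the direction conjugate to the derivative of \<open>G\<close> it equals the
        squared modulus of that derivative, which is nonzero.\<close>
      then have "Re (cnj (h z1) * D m * cnj (cnj (h z1) * D m)) = 0" by metis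
      then show False using G'0
        by (metis complex_norm_square Re_complex_of_real norm_eq_zero of_real_power power_eq_0_iff)
    qed
    have max: "Re (G z) \<le> Re (G m)" if "norm z \<le> norm m" for z
      using that m by auto
    define x where "x = Re (m * (cnj (h z1) * D m))"
    have "m * (cnj (h z1) * D m) = of_real x" "0 \<le> x"
      using Re_max_on_disc_derivative[OF Gm max] by (auto simp: x_def complex_eq_iff)
    then have "h m * (h z1 * cnj (h z1)) = of_real x * h z1"
      by (simp add: D(2) mult_ac)
    then have "h m = of_real (x / (norm (h z1))\<^sup>2) * h z1"
      using hz1 by (simp add: complex_norm_square[symmetric] field_simps)
    then show ?thesis
      by (rule starlike_univalent_ray[OF h z(1) \<open>norm m = norm z1\<close>]) (use \<open>0 \<le> x\<close> in simp)
  qed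
  have "continuous_on (cball 0 (norm z1)) (\<lambda>z. Re (G z))"
    using z(1) by (intro continuous_intros continuous_at_imp_continuous_on) (auto intro!: DERIV_isCont[OF G])
  then obtain m where m: "m \<in> cball 0 (norm z1)" "\<And>z. z \<in> cball 0 (norm z1) \<Longrightarrow> Re (G z) \<le> Re (G m)"
    using continuous_attains_sup[of "cball 0 (norm z1)" "\<lambda>z. Re (G z)"] by auto
  then have "m = z1" using uniq by auto
  then have max: "Re (G z) \<le> Re (G z1)" if "norm z \<le> norm z1" for z using m that by auto
  show ?thesis
  proof (rule ccontr)
    assume "\<not> ?thesis"
    then have "Re (G z) = Re (G z1)" using max[OF z(2)] by (simp add: G_def)
    then have "z = z1" using max uniq[OF z(2)] by simp
    then show False using z by simp
  qed
qed

section \<open>Subordination of primitives\<close>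

text \<open>This is Suffridge's theorem. The supporting lines make \<open>g\<close> univalent, so
  \<omega> has to be the inverse of \<open>g\<close> composed with \<open>Q\<close>. On each disc
  that \<open>Q\<close> maps into the image of \<open>g\<close>, Jack's lemma gives
  \<open>norm (\<omega> z) \<le> norm z\<close>, and this estimate in turn prevents \<open>Q\<close>
  from ever leaving that image.\<close>

lemma starlike_primitive_subordination:
  assumes h: "starlike_univalent h"
    and D: "D holomorphic_on ball 0 1" "\<And>z. h z = z * D z"
    and g: "\<And>z. norm z < 1 \<Longrightarrow> (g has_field_derivative D z) (at z)" "g 0 = 0"
    and q: "q holomorphic_on ball 0 1" "q ` ball 0 1 \<subseteq> h ` ball 0 1" "\<And>z. norm z < 1 \<Longrightarrow> q z = z * E z"
    and Q: "\<And>z. norm z < 1 \<Longrightarrow> (Q has_field_derivative E z) (at z)" "Q 0 = 0"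
  obtains \<omega> where "\<omega> holomorphic_on ball 0 1" "\<omega> 0 = 0"
    "\<And>z. norm z < 1 \<Longrightarrow> g (\<omega> z) = Q z" "\<And>z. norm z < 1 \<Longrightarrow> norm (\<omega> z) \<le> norm z"
proof -
  have hh: "h holomorphic_on ball 0 1" "inj_on h (ball 0 1)" "h 0 = 0"
    using h by (auto simp: starlike_univalent_def)
  obtain \<sigma> where \<sigma>: "\<And>z. norm z < 1 \<Longrightarrow> h (\<sigma> z) = q z" "\<And>z. norm z < 1 \<Longrightarrow> norm (\<sigma> z) < 1"
    "\<And>z. norm z < 1 \<Longrightarrow> norm (\<sigma> z) \<le> norm z"
    using subordination_Schwarz[OF hh q(1) _ q(2)] q(3)[of 0] by (metis mult_zero_left norm_zero zero_less_one)
  \<comment> \<open>The strict supporting inequality at whichever of \<open>x\<close>,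
    \<open>y\<close> has the larger modulus separates \<open>g x\<close> from
    \<open>g y\<close>.\<close>
  have g_inj: "inj_on g (ball 0 1)"
  proof (rule inj_onI, rule ccontr)
    fix x y assume "x \<in> ball 0 1" "y \<in> ball 0 1" "g x = g y" "x \<noteq> y"
    then show False
      using starlike_primitive_support[OF h D g(1), of x y] starlike_primitive_support[OF h D g(1), of y x]
      by (cases "norm x \<le> norm y") auto
  qed
  have g_hol: "g holomorphic_on ball 0 1"
    using g(1) by (auto simp: holomorphic_on_open intro!: exI)
  have Q_hol: "Q holomorphic_on ball 0 1"
    using Q(1) by (auto simp: holomorphic_on_open intro!: exI)
  obtain k where k: "k holomorphic_on (g ` ball 0 1)" "\<And>z. z \<in> ball 0 1 \<Longrightarrow> k (g z) = z"
    using holomorphic_has_inverse[OF g_hol open_ball g_inj] by metis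
  define \<omega> where "\<omega> = k \<circ> Q"
  have \<omega>0: "\<omega> 0 = 0" using k(2)[of 0] g(2) Q(2) by (simp add: \<omega>_def)
  \<comment> \<open>The range of \<open>Q\<close> is not yet known to lie in the image of
    \<open>g\<close>, so holomorphy and the bound are first established for every radius \<rho>
    where it does.\<close>
  have hol: "\<omega> holomorphic_on ball 0 \<rho>" if "\<rho> \<le> 1" "Q ` ball 0 \<rho> \<subseteq> g ` ball 0 1" for \<rho>
    unfolding \<omega>_def using that Q_hol
    by (intro holomorphic_on_compose_gen[OF _ k(1) that(2)]) (auto elim: holomorphic_on_subset)
  have g\<omega>: "g (\<omega> z) = Q z \<and> norm (\<omega> z) < 1" if "Q z \<in> g ` ball 0 1" for z
    using that k(2) by (force simp: \<omega>_def)
  \<comment> \<open>Jack's lemma: where \<open>\<omega> z / z\<close> is largest on a circle, \<open>z * \<omega>' = m * \<omega>\<close> with \<open>m \<ge> 1\<close>,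
    so that \<open>q z = m * h (\<omega> z)\<close> and starlikeness bounds \<open>\<omega> z\<close>.\<close>
  have bound: "norm (\<omega> z) \<le> norm z"
    if \<rho>: "\<rho> \<le> 1" "Q ` ball 0 \<rho> \<subseteq> g ` ball 0 1" and z: "norm z < \<rho>" for \<rho> z
  proof -
    obtain \<psi> where \<psi>: "\<psi> holomorphic_on ball 0 \<rho>" "\<And>z. \<omega> z = z * \<psi> z"
      using primitive_of_quotient[OF hol[OF \<rho>] \<omega>0] by metis
    have sub: "cball 0 (norm z) \<subseteq> ball 0 \<rho>" using z by auto
    have cont: "continuous_on (cball 0 (norm z)) \<psi>"
      using \<psi>(1) sub by (meson holomorphic_on_imp_continuous_on continuous_on_subset)
    have "\<exists>z0\<in>sphere 0 (norm z). \<forall>y\<in>sphere 0 (norm z). norm (\<psi> y) \<le> norm (\<psi> z0)"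
      by (rule continuous_attains_sup)
         (auto intro!: continuous_intros continuous_on_subset[OF cont])
    then obtain z0 where z0: "norm z0 = norm z" "\<And>y. norm y = norm z \<Longrightarrow> norm (\<psi> y) \<le> norm (\<psi> z0)"
      by auto
    have max: "norm (\<psi> y) \<le> norm (\<psi> z0)" if "norm y \<le> norm z0" for y
    proof (rule maximum_modulus_frontier[of \<psi> "cball 0 (norm z)"])
      show "\<psi> holomorphic_on interior (cball 0 (norm z))"
        using \<psi>(1) by (rule holomorphic_on_subset) (use z in auto)
    qed (use cont z0 that in auto)
    have z0\<rho>: "norm z0 < \<rho>" "norm z0 < 1" using z z0(1) \<rho>(1) by auto
    have "norm (\<omega> z0) \<le> norm z0"
    proof (cases "\<psi> z0 = 0")
      case False
      have d\<psi>: "(\<psi> has_field_derivative deriv \<psi> z0) (at z0)"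
        using z0\<rho> by (intro holomorphic_derivI[OF \<psi>(1)]) auto
      \<comment> \<open>Multiplying by \<open>cnj (\<psi> z0)\<close> turns the maximum of the
        modulus into a maximum of a real part, to which the first-order conditions apply.\<close>
      have le: "Re (cnj (\<psi> z0) * \<psi> y) \<le> Re (cnj (\<psi> z0) * \<psi> z0)" if "norm y \<le> norm z0" for y
      proof -
        have "Re (cnj (\<psi> z0) * \<psi> y) \<le> norm (\<psi> z0) * norm (\<psi> y)"
          using complex_Re_le_cmod[of "cnj (\<psi> z0) * \<psi> y"] by (simp add: norm_mult)
        also have "\<dots> \<le> norm (\<psi> z0) * norm (\<psi> z0)"
          by (intro mult_left_mono max that) simp
        also have "\<dots> = Re (cnj (\<psi> z0) * \<psi> z0)"
          by (metis Re_complex_of_real complex_norm_square mult.commute power2_eq_square of_real_power)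
        finally show ?thesis .
      qed
      \<comment> \<open>\<open>n\<close> is the real part of \<open>z * \<psi>' / \<psi>\<close> at
        \<open>z0\<close>; the first-order conditions make this quotient real and nonnegative, and
        the factor in Jack's lemma is \<open>1 + n\<close>.\<close>
      define n where "n = Re (z0 * (cnj (\<psi> z0) * deriv \<psi> z0)) / (norm (\<psi> z0))\<^sup>2"
      note mx = Re_max_on_disc_derivative[OF DERIV_cmult[OF d\<psi>, of "cnj (\<psi> z0)"] le]
      have n: "n \<ge> 0" using mx(2) by (simp add: n_def)
      have "z0 * (cnj (\<psi> z0) * deriv \<psi> z0) = of_real (n * (norm (\<psi> z0))\<^sup>2)"
        using mx(1) False by (simp add: n_def complex_eq_iff)
      also have "\<dots> = of_real n * (\<psi> z0 * cnj (\<psi> z0))"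
        by (simp only: of_real_mult complex_norm_square)
      finally have n_eq: "z0 * deriv \<psi> z0 = of_real n * \<psi> z0"
        using False by (simp add: mult_ac)
      have "((\<lambda>z. z * \<psi> z) has_field_derivative (\<psi> z0 + z0 * deriv \<psi> z0)) (at z0)"
        using DERIV_mult[OF DERIV_ident d\<psi>] by (simp add: add.commute mult.commute)
      then have d\<omega>: "(\<omega> has_field_derivative (\<psi> z0 + z0 * deriv \<psi> z0)) (at z0)"
        unfolding \<psi>(2)[symmetric] .
      have mem: "Q y \<in> g ` ball 0 1" if "y \<in> ball 0 \<rho>" for y using that \<rho> by auto
      have \<omega>1: "norm (\<omega> z0) < 1" using g\<omega>[OF mem] z0\<rho> by auto
      have "((\<lambda>z. g (\<omega> z)) has_field_derivative D (\<omega> z0) * (\<psi> z0 + z0 * deriv \<psi> z0)) (at z0)"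
        by (rule DERIV_chain2[OF g(1)[OF \<omega>1] d\<omega>])
      moreover have "((\<lambda>z. g (\<omega> z)) has_field_derivative E z0) (at z0)"
        by (rule has_field_derivative_transform_within_open[OF Q(1)[OF z0\<rho>(2)] open_ball[of 0 \<rho>]])
           (use z0\<rho> g\<omega>[OF mem] in auto)
      ultimately have "E z0 = D (\<omega> z0) * (\<psi> z0 + z0 * deriv \<psi> z0)"
        by (rule DERIV_unique[rotated])
      then have "q z0 = of_real (1 + n) * h (\<omega> z0)"
        using q(3)[OF z0\<rho>(2)] unfolding n_eq D(2) by (simp add: \<psi>(2) algebra_simps)
      moreover have "of_real (1 + n) \<noteq> (0::complex)" using n by (simp del: of_real_add)
      ultimately have "h (\<omega> z0) = of_real (1 / (1 + n)) * h (\<sigma> z0)"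
        using \<sigma>(1)[OF z0\<rho>(2)] by (simp add: field_simps)
      then have "norm (\<omega> z0) \<le> norm (\<sigma> z0)"
        by (rule starlike_univalent_level_le(1)[OF h \<sigma>(2)[OF z0\<rho>(2)] \<omega>1]) (use n in auto)
      with \<sigma>(3)[OF z0\<rho>(2)] show ?thesis by simp
    qed (use \<psi>(2) in simp)
    then have "norm z0 * norm (\<psi> z0) \<le> norm z0" by (simp add: \<psi>(2) norm_mult)
    moreover have "norm z * norm (\<psi> z) \<le> norm z0 * norm (\<psi> z0)"
      using z0 max[of z] by (simp add: mult_left_mono)
    ultimately show ?thesis using z0 by (simp add: \<psi>(2) norm_mult)
  qed
  have V: "open (g ` ball 0 1)"
    by (rule open_mapping_thm3[OF g_hol open_ball g_inj])
  \<comment> \<open>Take a point \<open>y\<close> of least modulus at which \<open>Q\<close> leaves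
    the image of \<open>g\<close>. On the open disc of radius \<open>norm y\<close> the bound keeps
    \<omega> in the closed disc of that radius, so \<open>Q\<close> stays in a compact subset of the
    image of \<open>g\<close>; by continuity \<open>Q y\<close> lies in it too.\<close>
  have sub: "Q ` ball 0 1 \<subseteq> g ` ball 0 1"
  proof (rule ccontr)
    assume "\<not> ?thesis"
    then obtain z where z: "norm z < 1" "Q z \<notin> g ` ball 0 1"
      by (metis image_subsetI mem_ball_0)
    define S where "S = cball 0 (norm z) \<inter> Q -` (- g ` ball 0 1)"
    have "continuous_on (cball 0 (norm z)) Q"
      using z(1) by (intro continuous_on_subset[OF holomorphic_on_imp_continuous_on[OF Q_hol]]) auto
    then have "closed S" unfolding S_def
      by (rule continuous_closed_preimage) (use V in auto)
    then have "compact S"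
      by (auto simp: compact_eq_bounded_closed S_def intro: bounded_subset[OF bounded_cball])
    moreover have "S \<noteq> {}" using z by (auto simp: S_def)
    ultimately obtain y where y: "y \<in> S" "\<And>x. x \<in> S \<Longrightarrow> norm y \<le> norm x"
      using continuous_attains_inf[of S norm] by (auto intro: continuous_intros)
    have y1: "norm y < 1" using y(1) z(1) by (auto simp: S_def)
    have y0: "y \<noteq> 0" using y(1) g(2) Q(2) by (force simp: S_def)
    have sub: "Q ` ball 0 (norm y) \<subseteq> g ` ball 0 1"
    proof (rule image_subsetI, rule ccontr)
      fix x assume x: "x \<in> ball 0 (norm y)" "Q x \<notin> g ` ball 0 1"
      then have "x \<in> S" using y(1) unfolding S_def by simp
      then show False using y(2)[of x] x(1) by simp
    qed
    have "Q ` closure (ball 0 (norm y)) \<subseteq> g ` cball 0 (norm y)"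
    proof (rule image_closure_subset)
      show "continuous_on (closure (ball 0 (norm y))) Q"
        using y1 y0 by (intro continuous_on_subset[OF holomorphic_on_imp_continuous_on[OF Q_hol]]) auto
      show "closed (g ` cball 0 (norm y))"
        using y1 by (intro compact_imp_closed compact_continuous_image compact_cball
            continuous_on_subset[OF holomorphic_on_imp_continuous_on[OF g_hol]]) auto
      show "Q ` ball 0 (norm y) \<subseteq> g ` cball 0 (norm y)"
      proof
        fix w assume "w \<in> Q ` ball 0 (norm y)"
        then obtain x where x: "norm x < norm y" "w = Q x" by auto
        have "norm (\<omega> x) \<le> norm y"
          using bound[OF _ sub x(1)] y1 x by simp
        moreover have "Q x \<in> g ` ball 0 1" using sub x by (meson image_subset_iff mem_ball_0)
        then have "w = g (\<omega> x)" using g\<omega>[of x] x(2) by simp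
        ultimately show "w \<in> g ` cball 0 (norm y)" by auto
      qed
    qed
    moreover have "y \<in> closure (ball 0 (norm y))" using y0 by simp
    ultimately have "Q y \<in> g ` cball 0 (norm y)" by blast
    then have "Q y \<in> g ` ball 0 1" using y1 by auto
    then show False using y(1) by (auto simp: S_def)
  qed
  then have "Q z \<in> g ` ball 0 1" if "norm z < 1" for z
    using that by (meson image_subset_iff mem_ball_0)
  then show thesis
    using that[OF hol[OF order_refl sub] \<omega>0] g\<omega> bound[OF order_refl sub] by blast
qed

section \<open>Poisson integrals and Littlewood subordination\<close>

text \<open>The factor \<open>1 / (2 * pi)\<close> is left out, so for \<open>norm w < R\<close> the
  total mass over the circle is \<open>2 * pi\<close>.\<close>

definition poisson_kernel :: "real \<Rightarrow> complex \<Rightarrow> real \<Rightarrow> real" where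
  "poisson_kernel R w s = (R\<^sup>2 - (norm w)\<^sup>2) / (norm (of_real R * exp (\<i> * of_real s) - w))\<^sup>2"

lemma norm_circle_point: "norm (of_real r * exp (\<i> * of_real s)) = \<bar>r\<bar>"
  by (simp add: norm_mult)

lemma poisson_kernel_nonneg: "norm w < R \<Longrightarrow> 0 \<le> poisson_kernel R w s"
  unfolding poisson_kernel_def by (intro divide_nonneg_nonneg) (auto simp: power_mono)

text \<open>Only circle means are used. \<open>B\<close> is \<open>F\<close> times a holomorphic
  factor equal to 1 at \<open>w\<close>, and \<open>T\<close> is its difference quotient at
  \<open>w\<close>. On the circle the integrand splits as \<zeta> \<open>T\<close> plus
  \<open>F w * cnj K\<close>: the first term has mean 0, and the second has mean \<open>F w\<close>
  because \<open>K 0 = 1\<close>.\<close>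

lemma Poisson_formula:
  fixes F :: "complex \<Rightarrow> complex"
  assumes F: "F holomorphic_on ball 0 \<rho>" and R: "norm w < R" "R < \<rho>"
  shows "((\<lambda>s. of_real (poisson_kernel R w s) * F (of_real R * exp (\<i> * of_real s)))
           has_integral (2 * pi * F w)) {-pi..pi}"
proof -
  let ?c = "\<lambda>s::real. of_real R * exp (\<i> * of_real s) :: complex"
  have R0: "R > 0" using R norm_ge_zero[of w] by linarith
  \<comment> \<open>For nonzero \<open>w\<close> the pole of \<open>K\<close> and \<open>B\<close>
    has modulus \<open>R^2 / norm w\<close>. The bound \<open>2 * R^2 / (norm w + R)\<close> lies
    strictly between \<open>R\<close> and that modulus, and it remains meaningful for
    \<open>w = 0\<close>.\<close>
  define \<rho>' where "\<rho>' = min \<rho> (2 * R\<^sup>2 / (norm w + R))"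
  have wR: "norm w + R > 0" using R0 by (simp add: add_nonneg_pos)
  have "R * (norm w + R) < 2 * R\<^sup>2"
    using R R0 by (simp add: power2_eq_square algebra_simps)
  then have \<rho>': "R < \<rho>'" "\<rho>' \<le> \<rho>" using R wR by (auto simp: \<rho>'_def field_simps)
  have ne: "(of_real R)\<^sup>2 - cnj w * \<zeta> \<noteq> 0" if "norm \<zeta> < \<rho>'" for \<zeta> :: complex
  proof
    assume "(of_real R)\<^sup>2 - cnj w * \<zeta> = 0"
    then have "norm (cnj w * \<zeta>) = R\<^sup>2" by (metis eq_iff_diff_eq_0 norm_of_real abs_power2 of_real_power)
    then have "R\<^sup>2 = norm w * norm \<zeta>" by (simp add: norm_mult)
    also have "\<dots> \<le> norm w * (2 * R\<^sup>2 / (norm w + R))"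
      using that by (intro mult_left_mono) (auto simp: \<rho>'_def)
    also have "\<dots> < R\<^sup>2"
    proof -
      have "norm w * (2 * R\<^sup>2) < R\<^sup>2 * (norm w + R)"
        using R R0 by (simp add: algebra_simps)
      then show ?thesis using wR by (simp add: field_simps)
    qed
    finally show False by simp
  qed
  have F': "F holomorphic_on ball 0 \<rho>'" using F \<rho>' by (auto elim: holomorphic_on_subset)
  define K where "K \<zeta> = (of_real R)\<^sup>2 / ((of_real R)\<^sup>2 - cnj w * \<zeta>)" for \<zeta> :: complex
  define B where "B \<zeta> = F \<zeta> * ((of_real R)\<^sup>2 - w * cnj w) / ((of_real R)\<^sup>2 - cnj w * \<zeta>)" for \<zeta>
  have K: "K holomorphic_on ball 0 \<rho>'" unfolding K_def by (intro holomorphic_intros) (use ne in auto)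
  have B: "B holomorphic_on ball 0 \<rho>'" unfolding B_def by (intro holomorphic_intros F') (use ne in auto)
  have Bw: "B w = F w" using ne[of w] R \<rho>' by (simp add: B_def mult.commute)
  define T where "T \<zeta> = (if \<zeta> = w then deriv B w else (B \<zeta> - B w) / (\<zeta> - w))" for \<zeta>
  have "T holomorphic_on ball 0 \<rho>'" unfolding T_def[abs_def] by (rule pole_lemma_open[OF B open_ball])
  then have "(\<lambda>\<zeta>. \<zeta> * T \<zeta>) holomorphic_on ball 0 \<rho>'" by (intro holomorphic_intros)
  from holomorphic_circle_mean[OF this, of R] R0 \<rho>'
  have 1: "((\<lambda>s. ?c s * T (?c s)) has_integral 0) {-pi..pi}" by simp
  have "((\<lambda>s. K (?c s)) has_integral (2 * pi * K 0)) {-pi..pi}"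
    using R0 \<rho>' by (intro holomorphic_circle_mean[OF K]) auto
  from has_integral_linear[OF this bounded_linear_cnj]
  have "((\<lambda>s. cnj (K (?c s))) has_integral cnj (2 * pi * K 0)) {-pi..pi}"
    unfolding o_def .
  then have 2: "((\<lambda>s. F w * cnj (K (?c s))) has_integral (F w * (2 * pi))) {-pi..pi}"
    using R0 by (intro has_integral_mult_right) (simp add: K_def)
  have "?c s * T (?c s) + F w * cnj (K (?c s)) = of_real (poisson_kernel R w s) * F (?c s)" for s
  proof -
    define \<zeta> where "\<zeta> = ?c s"
    have nz: "norm \<zeta> = R" using R0 by (simp add: \<zeta>_def norm_mult)
    have \<zeta>0: "\<zeta> \<noteq> 0" using nz R0 by auto
    have \<zeta>w: "\<zeta> - w \<noteq> 0" "cnj \<zeta> - cnj w \<noteq> 0" using nz R by (auto simp flip: complex_cnj_diff)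
    have RR: "(of_real R)\<^sup>2 = \<zeta> * cnj \<zeta>" using nz by (metis complex_norm_square of_real_power)
    have "cnj (K \<zeta>) = cnj (\<zeta> * cnj \<zeta> / (\<zeta> * (cnj \<zeta> - cnj w)))"
      unfolding K_def RR by (simp add: algebra_simps)
    also have "\<dots> = \<zeta> / (\<zeta> - w)" using \<zeta>0 \<zeta>w by simp
    finally have K\<zeta>: "cnj (K \<zeta>) = \<zeta> / (\<zeta> - w)" .
    have B\<zeta>: "B \<zeta> = F \<zeta> * (\<zeta> * cnj \<zeta> - w * cnj w) / (\<zeta> * (cnj \<zeta> - cnj w))"
      unfolding B_def RR by (simp add: algebra_simps)
    have "complex_of_real (poisson_kernel R w s) = ((of_real R)\<^sup>2 - of_real ((norm w)\<^sup>2)) / of_real ((norm (\<zeta> - w))\<^sup>2)"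
      by (simp add: poisson_kernel_def \<zeta>_def)
    also have "\<dots> = (\<zeta> * cnj \<zeta> - w * cnj w) / ((\<zeta> - w) * (cnj \<zeta> - cnj w))"
      by (simp only: RR complex_norm_square complex_cnj_diff)
    finally have P\<zeta>: "complex_of_real (poisson_kernel R w s) = (\<zeta> * cnj \<zeta> - w * cnj w) / ((\<zeta> - w) * (cnj \<zeta> - cnj w))" .
    have "\<zeta> * T \<zeta> + F w * cnj (K \<zeta>) = \<zeta> * B \<zeta> / (\<zeta> - w)"
      using \<zeta>w unfolding K\<zeta> T_def Bw by (simp add: diff_divide_distrib algebra_simps)
    also have "\<dots> = of_real (poisson_kernel R w s) * F \<zeta>"
      unfolding P\<zeta> B\<zeta> using \<zeta>0 by (simp add: mult_ac)
    finally show ?thesis by (simp add: \<zeta>_def)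
  qed
  with has_integral_add[OF 1 2] show ?thesis by (simp add: mult_ac)
qed

text \<open>For \<zeta> on the circle of radius \<open>R\<close>, the kernel at \<omega> is the real
  part of (\<zeta> + \<omega>) / (\<zeta> - \<omega>), which is holomorphic on the disc of radius
  \<open>R\<close> and equals 1 at 0. Here the averaging is over the interior point, not over the
  boundary point \<open>s\<close>.\<close>

lemma poisson_kernel_circle_mean:
  assumes \<omega>: "\<omega> holomorphic_on ball 0 1" "\<omega> 0 = 0" "\<And>z. norm z < 1 \<Longrightarrow> norm (\<omega> z) \<le> norm z"
    and R: "0 \<le> r" "r < R" "R \<le> 1"
  shows "((\<lambda>t. poisson_kernel R (\<omega> (of_real r * exp (\<i> * of_real t))) s) has_integral (2 * pi)) {-pi..pi}"
proof -
  define \<zeta> where "\<zeta> = of_real R * exp (\<i> * of_real s)"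
  have nz: "norm \<zeta> = R" using R by (simp add: \<zeta>_def norm_mult)
  have ne: "\<omega> z \<noteq> \<zeta>" if "norm z < R" for z
    using \<omega>(3)[of z] that R nz by auto
  have "(\<lambda>z. (\<zeta> + \<omega> z) / (\<zeta> - \<omega> z)) holomorphic_on ball 0 R"
    by (intro holomorphic_intros holomorphic_on_subset[OF \<omega>(1)]) (use R ne in auto)
  from has_integral_Re[OF holomorphic_circle_mean[OF this R(1,2)]]
  have *: "((\<lambda>t. Re ((\<zeta> + \<omega> (of_real r * exp (\<i> * of_real t))) / (\<zeta> - \<omega> (of_real r * exp (\<i> * of_real t)))))
     has_integral (2 * pi)) {-pi..pi}"
    using ne[of 0] R \<omega>(2) by auto
  have "Re ((\<zeta> + w) / (\<zeta> - w)) = poisson_kernel R w s" for w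
  proof -
    have "Re ((\<zeta> + w) / (\<zeta> - w)) = Re ((\<zeta> + w) * cnj (\<zeta> - w)) / (norm (\<zeta> - w))\<^sup>2"
      by (metis complex_div_cnj Re_divide_of_real of_real_power)
    also have "Re ((\<zeta> + w) * cnj (\<zeta> - w)) = (norm \<zeta>)\<^sup>2 - (norm w)\<^sup>2"
      by (simp add: cmod_power2) (simp add: algebra_simps power2_eq_square)
    finally show ?thesis by (simp add: poisson_kernel_def nz \<zeta>_def[symmetric])
  qed
  with * show ?thesis by simp
qed

lemma continuous_on_circle_compose:
  assumes "continuous_on (ball 0 1) F" "0 \<le> r" "r < 1"
  shows "continuous_on S (\<lambda>s. F (of_real r * exp (\<i> * of_real s)))"
  by (rule continuous_on_compose2[OF assms(1)]) (use assms in \<open>auto intro!: continuous_intros simp: norm_mult\<close>)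

text \<open>Jensen's inequality for the Poisson kernel bounds the left integrand at each
  \<open>t\<close>. Integrating in \<open>t\<close> and exchanging the integrals leaves the kernel's
  mean over \<open>t\<close>, which is \<open>2 * pi\<close> for every \<open>s\<close>. The gap
  \<open>r < R\<close> keeps the kernel continuous.\<close>

lemma Littlewood_subordination_convex_lt:
  fixes \<Psi> :: "real \<Rightarrow> real"
  assumes g: "g holomorphic_on ball 0 1"
    and \<omega>: "\<omega> holomorphic_on ball 0 1" "\<omega> 0 = 0" "\<And>z. norm z < 1 \<Longrightarrow> norm (\<omega> z) \<le> norm z"
    and \<Psi>: "convex_on UNIV \<Psi>" and R: "0 \<le> r" "r < R" "R < 1"
  shows "integral {-pi..pi} (\<lambda>t. \<Psi> (Re (g (\<omega> (of_real r * exp (\<i> * of_real t))))))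
       \<le> integral {-pi..pi} (\<lambda>s. \<Psi> (Re (g (of_real R * exp (\<i> * of_real s)))))"
proof -
  let ?c = "\<lambda>r s::real. of_real r * exp (\<i> * of_real s) :: complex"
  define w where "w t = \<omega> (?c r t)" for t
  define u where "u s = Re (g (?c R s))" for s
  have \<Psi>_cont: "continuous_on UNIV \<Psi>" using convex_on_continuous[OF open_UNIV \<Psi>] .
  have w_lt: "norm (w t) < R" for t
    using \<omega>(3)[of "?c r t"] R by (simp add: w_def norm_mult)
  have w_cont: "continuous_on S w" for S
    unfolding w_def using R
    by (intro continuous_on_circle_compose holomorphic_on_imp_continuous_on[OF \<omega>(1)]) auto
  have u_cont: "continuous_on S u" for S
    unfolding u_def using R
    by (intro continuous_intros continuous_on_circle_compose holomorphic_on_imp_continuous_on[OF g]) auto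
  have \<Psi>u_cont: "continuous_on S (\<lambda>s. \<Psi> (u s))" for S
    by (rule continuous_on_compose2[OF \<Psi>_cont u_cont]) auto
  have \<Psi>w_cont: "continuous_on S (\<lambda>t. \<Psi> (Re (g (w t))))" for S
    by (rule continuous_on_compose2[OF \<Psi>_cont], intro continuous_intros
        continuous_on_compose2[OF holomorphic_on_imp_continuous_on[OF g] w_cont])
       (use order.strict_trans[OF w_lt R(3)] in auto)
  have ne: "?c R s - w t \<noteq> 0" for s t
    using w_lt[of t] R norm_circle_point[of R s] by auto
  have P_cont: "continuous_on S (\<lambda>(t, s). poisson_kernel R (w t) s)" for S
    unfolding poisson_kernel_def split_beta
    by (intro continuous_intros continuous_on_compose2[OF w_cont[of UNIV]]) (use ne in auto)
  have Pt_cont: "continuous_on S (poisson_kernel R (w t))" for S t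
    unfolding poisson_kernel_def[abs_def] by (intro continuous_intros) (use ne in auto)
  have jensen: "2 * pi * \<Psi> (Re (g (w t))) \<le> integral {-pi..pi} (\<lambda>s. poisson_kernel R (w t) s * \<Psi> (u s))" for t
  proof -
    define x where "x = Re (g (w t))"
    \<comment> \<open>\<open>k\<close> is the right derivative of \<Psi> at \<open>x\<close>, used
      as the slope of a supporting line; integrating that line against the kernel proves Jensen's
      inequality.\<close>
    define k where "k = Inf ((\<lambda>t. (\<Psi> x - \<Psi> t) / (x - t)) ` ({x<..} \<inter> UNIV))"
    have supp: "\<Psi> y \<ge> \<Psi> x + k * (y - x)" for y
      unfolding k_def by (rule convex_le_Inf_differential[OF \<Psi>]) auto
    have 1: "((\<lambda>s. poisson_kernel R (w t) s * u s) has_integral (2 * pi * x)) {-pi..pi}"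
      using has_integral_Re[OF Poisson_formula[OF g w_lt R(3)]] by (simp add: u_def x_def)
    have 2: "((\<lambda>s. poisson_kernel R (w t) s) has_integral (2 * pi)) {-pi..pi}"
      using has_integral_Re[OF Poisson_formula[OF holomorphic_on_const[of 1] w_lt R(3)]] by simp
    have 3: "((\<lambda>s. k * (poisson_kernel R (w t) s * u s) + (\<Psi> x - k * x) * poisson_kernel R (w t) s)
      has_integral (k * (2 * pi * x) + (\<Psi> x - k * x) * (2 * pi))) {-pi..pi}"
      by (intro has_integral_add has_integral_mult_right 1 2)
    have "k * (2 * pi * x) + (\<Psi> x - k * x) * (2 * pi) \<le> integral {-pi..pi} (\<lambda>s. poisson_kernel R (w t) s * \<Psi> (u s))"
    proof (rule has_integral_le[OF 3 integrable_integral])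
      show "(\<lambda>s. poisson_kernel R (w t) s * \<Psi> (u s)) integrable_on {-pi..pi}"
        by (intro integrable_continuous_real continuous_intros Pt_cont \<Psi>u_cont)
      show "k * (poisson_kernel R (w t) s * u s) + (\<Psi> x - k * x) * poisson_kernel R (w t) s
          \<le> poisson_kernel R (w t) s * \<Psi> (u s)" for s
        using mult_left_mono[OF supp[of "u s"] poisson_kernel_nonneg[OF w_lt, of t s]]
        by (simp add: algebra_simps)
    qed
    then show ?thesis by (simp add: x_def algebra_simps)
  qed
  have cont2: "continuous_on S (\<lambda>(t, s). poisson_kernel R (w t) s * \<Psi> (u s))" for S
    unfolding split_beta
    by (intro continuous_intros continuous_on_compose2[OF \<Psi>u_cont[of UNIV]])
       (use P_cont in \<open>auto simp: split_beta\<close>)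
  have "2 * pi * integral {-pi..pi} (\<lambda>t. \<Psi> (Re (g (w t)))) = integral {-pi..pi} (\<lambda>t. 2 * pi * \<Psi> (Re (g (w t))))"
    by simp
  also have "\<dots> \<le> integral {-pi..pi} (\<lambda>t. integral {-pi..pi} (\<lambda>s. poisson_kernel R (w t) s * \<Psi> (u s)))"
  proof (rule integral_le)
    show "(\<lambda>t. integral {-pi..pi} (\<lambda>s. poisson_kernel R (w t) s * \<Psi> (u s))) integrable_on {-pi..pi}"
      using integral_continuous_on_param[of "{-pi..pi}" "-pi" pi "\<lambda>t s. poisson_kernel R (w t) s * \<Psi> (u s)", OF cont2]
      by (intro integrable_continuous_real) (simp add: cbox_interval)
  qed (use jensen in \<open>auto intro!: integrable_continuous_real continuous_intros \<Psi>w_cont\<close>)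
  also have "\<dots> = integral {-pi..pi} (\<lambda>s. integral {-pi..pi} (\<lambda>t. poisson_kernel R (w t) s * \<Psi> (u s)))"
    using integral_swap_continuous[OF cont2] by (simp add: cbox_interval)
  also have "\<dots> = integral {-pi..pi} (\<lambda>s. 2 * pi * \<Psi> (u s))"
    using poisson_kernel_circle_mean[OF \<omega> R(1,2) less_imp_le[OF R(3)]]
    by (intro integral_cong) (simp add: w_def integral_unique)
  also have "\<dots> = 2 * pi * integral {-pi..pi} (\<lambda>s. \<Psi> (u s))" by simp
  finally show ?thesis by (simp add: w_def u_def)
qed

text \<open>The left side of the strict version does not involve \<open>R\<close>, and the right
  side is continuous in \<open>R\<close>; let \<open>R\<close> decrease to \<open>r\<close>.\<close>

lemma Littlewood_subordination_convex:
  fixes \<Psi> :: "real \<Rightarrow> real"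
  assumes g: "g holomorphic_on ball 0 1"
    and \<omega>: "\<omega> holomorphic_on ball 0 1" "\<omega> 0 = 0" "\<And>z. norm z < 1 \<Longrightarrow> norm (\<omega> z) \<le> norm z"
    and \<Psi>: "convex_on UNIV \<Psi>" and r: "0 \<le> r" "r < 1"
  shows "integral {-pi..pi} (\<lambda>t. \<Psi> (Re (g (\<omega> (of_real r * exp (\<i> * of_real t))))))
       \<le> integral {-pi..pi} (\<lambda>s. \<Psi> (Re (g (of_real r * exp (\<i> * of_real s)))))"
proof -
  let ?I = "\<lambda>R::real. integral {-pi..pi} (\<lambda>s. \<Psi> (Re (g (of_real R * exp (\<i> * of_real s)))))"
  have "continuous_on ({0..<1} \<times> cbox (-pi) pi) (\<lambda>(R, s). \<Psi> (Re (g (of_real R * exp (\<i> * of_real s)))))"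
    unfolding split_beta
    by (rule continuous_on_compose2[OF convex_on_continuous[OF open_UNIV \<Psi>]], intro continuous_intros
        continuous_on_compose2[OF holomorphic_on_imp_continuous_on[OF g]]) (auto simp: norm_mult)
  from integral_continuous_on_param[OF this]
  have "continuous_on {0..<1} ?I" by (simp add: cbox_interval)
  then have "(?I \<longlongrightarrow> ?I r) (at r within {0..<1})" using r by (simp add: continuous_on_def)
  then have lim: "(?I \<longlongrightarrow> ?I r) (at r within {r<..<1})"
    by (rule tendsto_within_subset) (use r in auto)
  show ?thesis
  proof (rule tendsto_lowerbound[OF lim])
    show "\<forall>\<^sub>F R in at r within {r<..<1}. integral {-pi..pi} (\<lambda>t. \<Psi> (Re (g (\<omega> (of_real r * exp (\<i> * of_real t)))))) \<le> ?I R"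
      unfolding eventually_at_filter
      by (rule always_eventually) (use Littlewood_subordination_convex_lt[OF g \<omega> \<Psi> r(1)] in auto)
    show "at r within {r<..<1} \<noteq> bot"
      using r(2) by (simp add: at_within_eq_bot_iff)
  qed
qed

section \<open>Univalent maps with real symmetry\<close>

text \<open>The reflected map \<open>q\<close> shares with \<open>h\<close> its image, its value at
  0 and its real derivative at 0. The Schwarz function \<sigma> with h \<circ> \<sigma> = q
  therefore has derivative 1 at 0, and the equality case of the Schwarz lemma makes it the
  identity.\<close>

lemma univalent_real_symmetric:
  assumes h: "h holomorphic_on ball 0 1" "inj_on h (ball 0 1)" "h 0 = 0"
    and sym: "cnj ` h ` ball 0 1 = h ` ball 0 1" and real: "Im (deriv h 0) = 0"
    and z: "norm z < 1"
  shows "h (cnj z) = cnj (h z)"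
proof -
  have cb: "cnj ` ball 0 1 = ball 0 1"
    by (auto simp: image_cnj_conv_vimage_cnj)
  define q where "q = cnj \<circ> h \<circ> cnj"
  have q: "q holomorphic_on ball 0 1"
    unfolding q_def by (rule holomorphic_on_compose_cnj_cnj) (simp_all add: cb h)
  have "q ` ball 0 1 = cnj ` h ` cnj ` ball 0 1" by (simp add: q_def image_image)
  then have sub: "q ` ball 0 1 \<subseteq> h ` ball 0 1" using sym cb by simp
  have "q 0 = 0" using h(3) by (simp add: q_def)
  then obtain \<sigma> where \<sigma>: "\<sigma> holomorphic_on ball 0 1" "\<sigma> 0 = 0"
    "\<And>z. norm z < 1 \<Longrightarrow> h (\<sigma> z) = q z" "\<And>z. norm z < 1 \<Longrightarrow> norm (\<sigma> z) < 1"
    using subordination_Schwarz[OF h q _ sub] by metis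
  have dh: "(h has_field_derivative deriv h 0) (at 0)"
    using h(1) by (meson holomorphic_derivI open_ball centre_in_ball zero_less_one)
  have d\<sigma>: "(\<sigma> has_field_derivative deriv \<sigma> 0) (at 0)"
    using \<sigma>(1) by (meson holomorphic_derivI open_ball centre_in_ball zero_less_one)
  have "cnj (deriv h 0) = deriv h 0" using real by (simp add: complex_eq_iff)
  then have dq: "(q has_field_derivative deriv h 0) (at 0)"
    using has_field_derivative_cnj_cnj[of h "deriv h 0" 0] dh by (simp add: q_def)
  have "((\<lambda>z. h (\<sigma> z)) has_field_derivative deriv h 0 * deriv \<sigma> 0) (at 0)"
    using DERIV_chain2[OF _ d\<sigma>] dh \<sigma>(2) by simp
  moreover have "((\<lambda>z. h (\<sigma> z)) has_field_derivative deriv h 0) (at 0)"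
    by (rule has_field_derivative_transform_within_open[OF dq open_ball[of 0 1]]) (use \<sigma>(3) in auto)
  ultimately have "deriv h 0 * deriv \<sigma> 0 = deriv h 0" by (rule DERIV_unique)
  moreover have "deriv h 0 \<noteq> 0"
    using holomorphic_injective_imp_regular[OF h(1) open_ball h(2)] by simp
  ultimately have 1: "deriv \<sigma> 0 = 1" by simp
  then obtain \<alpha> where \<alpha>: "\<And>z. norm z < 1 \<Longrightarrow> \<sigma> z = \<alpha> * z"
    using Schwarz_Lemma(3)[OF \<sigma>(1,2,4), of 0] by auto
  have "(\<sigma> has_field_derivative \<alpha>) (at 0)"
    by (rule has_field_derivative_transform_within_open[OF DERIV_cmult_Id open_ball[of 0 1]])
       (use \<alpha> in auto)
  then have "\<alpha> = 1" using 1 by (simp add: DERIV_imp_deriv)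
  then have "h (cnj z) = q (cnj z)" using \<sigma>(3)[of "cnj z"] \<alpha>[of "cnj z"] z by simp
  then show ?thesis by (simp add: q_def)
qed

text \<open>A real value at a nonreal \<open>x\<close> would be shared with \<open>cnj x\<close>,
  against injectivity. So \<open>Im h\<close> has no zero on the connected upper half disc, and its
  sign can be read off at small points of the imaginary axis from the derivative at 0.\<close>

lemma univalent_real_symmetric_Im_pos:
  assumes h: "h holomorphic_on ball 0 1" "inj_on h (ball 0 1)" "h 0 = 0"
    and sym: "\<And>z. norm z < 1 \<Longrightarrow> h (cnj z) = cnj (h z)" and pos: "Re (deriv h 0) > 0"
    and z: "norm z < 1" "Im z > 0"
  shows "Im (h z) > 0"
proof (rule ccontr)
  assume neg: "\<not> Im (h z) > 0"
  define U where "U = ball 0 1 \<inter> {z. Im z > 0}"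
  have ne: "Im (h x) \<noteq> 0" if "x \<in> U" for x
  proof
    assume "Im (h x) = 0"
    then have "h (cnj x) = h x" using sym[of x] that by (auto simp: U_def complex_eq_iff)
    then have "cnj x = x" using that h(2) by (auto simp: U_def inj_on_def)
    then show False using that by (auto simp: U_def complex_eq_iff)
  qed
  have "connected U"
    unfolding U_def by (intro convex_connected convex_Int convex_ball convex_halfspace_Im_gt)
  moreover have "continuous_on U (\<lambda>x. Im (h x))"
    by (intro continuous_intros continuous_on_subset[OF holomorphic_on_imp_continuous_on[OF h(1)]])
       (auto simp: U_def)
  ultimately have conn: "connected ((\<lambda>x. Im (h x)) ` U)"
    by (intro connected_continuous_image)
  have dh: "(h has_field_derivative deriv h 0) (at 0)"
    using h(1) by (meson holomorphic_derivI open_ball centre_in_ball zero_less_one)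
  have "((\<lambda>w. \<i> * w) has_field_derivative \<i>) (at (of_real 0))"
    by (auto intro!: derivative_eq_intros)
  from DERIV_chain2[OF _ this, of h "deriv h 0"] dh
  have "((\<lambda>w. h (\<i> * w)) has_field_derivative deriv h 0 * \<i>) (at (of_real 0))"
    by simp
  from has_field_derivative_Im[OF has_vector_derivative_real_field[OF this]]
  have "((\<lambda>y. Im (h (\<i> * of_real y))) has_real_derivative Re (deriv h 0)) (at 0)" by simp
  from DERIV_pos_inc_right[OF this pos] obtain d where
    d: "d > 0" "\<And>y. 0 < y \<Longrightarrow> y < d \<Longrightarrow> 0 < Im (h (\<i> * of_real y))"
    using h(3) by auto
  define y where "y = min (d/2) (1/2)"
  have y: "0 < y" "y < d" "y < 1" using d by (auto simp: y_def)
  then have "\<i> * of_real y \<in> U" by (auto simp: U_def norm_mult)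
  moreover have "z \<in> U" using z by (simp add: U_def)
  ultimately have "{Im (h z)..Im (h (\<i> * of_real y))} \<subseteq> (\<lambda>x. Im (h x)) ` U"
    by (intro connected_contains_Icc[OF conn] imageI)
  moreover have "0 \<in> {Im (h z)..Im (h (\<i> * of_real y))}" using d(2)[OF y(1,2)] neg by simp
  ultimately have "0 \<in> (\<lambda>x. Im (h x)) ` U" by (rule subsetD)
  then show False using ne by auto
qed

section \<open>The logarithm of the derivative of \<open>kfun\<close>\<close>

lemma Re_along_circle_has_derivative:
  assumes "(g has_field_derivative D) (at (of_real r * exp (\<i> * of_real s)))"
  shows "((\<lambda>s. Re (g (of_real r * exp (\<i> * of_real s)))) has_real_derivative
          - Im (of_real r * exp (\<i> * of_real s) * D)) (at s)"
  using has_field_derivative_Re[OF has_vector_derivative_along_circle[OF assms]]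
  by (simp add: mult.assoc)

lemma contour_integral_linepath_primitive_quotient:
  assumes g: "\<And>z. norm z < 1 \<Longrightarrow> (g has_field_derivative D z) (at z)" "g 0 = 0"
    and D: "\<And>z. h z = z * D z" and z: "norm z < 1"
  shows "contour_integral (linepath 0 z) (\<lambda>\<zeta>. h \<zeta> / \<zeta>) = g z"
proof (cases "z = 0")
  case False
  have sub: "closed_segment 0 z \<subseteq> ball 0 1"
    using z by (intro closed_segment_subset) auto
  have "(D has_contour_integral (g (pathfinish (linepath 0 z)) - g (pathstart (linepath 0 z)))) (linepath 0 z)"
    using g(1) sub
    by (intro contour_integral_primitive[of "ball 0 1", OF _ valid_path_linepath])
       (auto intro: has_field_derivative_at_within simp only: path_image_linepath mem_ball_0)
  then have "((\<lambda>x. D (linepath 0 z x) * z) has_integral g z) {0..1}"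
    using g(2) by (simp add: has_contour_integral_linepath)
  \<comment> \<open>At parameter 0 division by zero gives the value 0 in place of
    \<open>D 0 * z\<close>; a single point does not change the integral.\<close>
  then have "((\<lambda>x. h (linepath 0 z x) / linepath 0 z x * z) has_integral g z) {0..1}"
    by (rule has_integral_spike_finite[of "{0}", rotated 2]) (use False in \<open>auto simp: D scaleR_conv_of_real\<close>)
  then show ?thesis
    by (intro contour_integral_unique) (simp add: has_contour_integral_linepath)
qed (simp add: g(2))

text \<open>The inner integral in \<open>kfun\<close> evaluates to \<open>g\<close>, so on the disc
  \<open>kfun\<close> coincides with the primitive of \<open>exp (g z)\<close> that vanishes at
  0.\<close>

lemma deriv_kfun:
  assumes g: "\<And>z. norm z < 1 \<Longrightarrow> (g has_field_derivative D z) (at z)" "g 0 = 0"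
    and D: "\<And>z. \<phi> z - 1 = z * D z" and z: "norm z < 1"
  shows "deriv (kfun \<phi>) z = exp (g z)"
proof -
  have "g holomorphic_on ball 0 1" using g(1) by (auto simp: holomorphic_on_open intro!: exI)
  then have "(\<lambda>z. exp (g z)) holomorphic_on ball 0 1" by (intro holomorphic_intros)
  then obtain K where K: "\<And>x. x \<in> ball 0 1 \<Longrightarrow> (K has_field_derivative exp (g x)) (at x within ball 0 1)"
    using holomorphic_convex_primitive'[OF convex_ball open_ball] by metis
  have kfun: "kfun \<phi> x = K x - K 0" if x: "x \<in> ball 0 1" for x
  proof -
    have sub: "closed_segment 0 x \<subseteq> ball 0 1"
      using x by (intro closed_segment_subset) auto
    have "kfun \<phi> x = contour_integral (linepath 0 x) (\<lambda>t. exp (g t))"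
      unfolding kfun_def using sub contour_integral_linepath_primitive_quotient[OF g D]
      by (intro contour_integral_eq) auto
    also have "\<dots> = K (pathfinish (linepath 0 x)) - K (pathstart (linepath 0 x))"
      using sub by (intro contour_integral_unique contour_integral_primitive[OF K valid_path_linepath])
        (auto simp only: path_image_linepath)
    finally show ?thesis by simp
  qed
  have "((\<lambda>x. K x - K 0) has_field_derivative exp (g z)) (at z)"
    using DERIV_diff[OF K[of z] DERIV_const[of "K 0"]] z by (simp add: at_within_open[of z "ball 0 1"])
  then have "(kfun \<phi> has_field_derivative exp (g z)) (at z)"
    by (rule has_field_derivative_transform_within_open[where S = "ball 0 1"]) (use z kfun in auto)
  then show ?thesis by (rule DERIV_imp_deriv)
qed

section \<open>Rearrangement through positive parts\<close>

text \<open>This admits the excess of \<Phi> over any level \<open>t\<close> as a convex function in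
  Littlewood subordination, which supplies the hypothesis \<open>le\<close> of the rearrangement
  lemma.\<close>

lemma convex_on_positive_part:
  fixes \<Phi> :: "real \<Rightarrow> real"
  assumes "convex_on UNIV \<Phi>"
  shows "convex_on UNIV (\<lambda>x. max (\<Phi> x - t) 0)"
proof (rule convex_onI)
  fix u x y :: real assume u: "0 < u" "u < 1"
  have "\<Phi> ((1 - u) *\<^sub>R x + u *\<^sub>R y) - t \<le> (1 - u) * (\<Phi> x - t) + u * (\<Phi> y - t)"
    using convex_onD[OF assms, of u x y] u by (simp add: algebra_simps)
  also have "\<dots> \<le> (1 - u) * max (\<Phi> x - t) 0 + u * max (\<Phi> y - t) 0"
    using u by (intro add_mono mult_left_mono) auto
  finally show "max (\<Phi> ((1 - u) *\<^sub>R x + u *\<^sub>R y) - t) 0 \<le> (1 - u) * max (\<Phi> x - t) 0 + u * max (\<Phi> y - t) 0"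
    using u by simp
qed simp

text \<open>Taking \<open>t = k \<theta>\<close>, the positive part of \<open>k - t\<close> is supported in \<open>{-\<theta>..\<theta>}\<close>, whereas the integral
  of \<open>v\<close> over \<open>E\<close> is at most \<open>2 * \<theta> * t\<close> plus the integral of the positive part of \<open>v - t\<close>.\<close>
lemma set_integral_le_symmetric_decreasing:
  fixes v k :: "real \<Rightarrow> real"
  assumes v: "continuous_on {-pi..pi} v" and k: "continuous_on {-pi..pi} k"
    and even: "\<And>s. s \<in> {-pi..pi} \<Longrightarrow> k (- s) = k s"
    and decr: "\<And>a b. 0 \<le> a \<Longrightarrow> a \<le> b \<Longrightarrow> b \<le> pi \<Longrightarrow> k b \<le> k a"
    and le: "\<And>t. integral {-pi..pi} (\<lambda>s. max (v s - t) 0) \<le> integral {-pi..pi} (\<lambda>s. max (k s - t) 0)"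
    and \<theta>: "0 \<le> \<theta>" "\<theta> \<le> pi"
    and E: "E \<in> sets lebesgue" "E \<subseteq> {-pi..pi}" "emeasure lebesgue E = ennreal (2 * \<theta>)"
  shows "(LINT s:E|lebesgue. v s) \<le> (LINT s:{-\<theta>..\<theta>}|lebesgue. k s)"
proof -
  define t where "t = k \<theta>"
  have abs_k: "k s = k \<bar>s\<bar>" if "s \<in> {-pi..pi}" for s
    using even[of s] that by (cases "s \<ge> 0") auto
  have k_ge: "k s \<ge> t" if "s \<in> {-\<theta>..\<theta>}" for s
    using abs_k[of s] decr[of "\<bar>s\<bar>" \<theta>] that \<theta> by (auto simp: t_def)
  have k_le: "k s \<le> t" if "s \<in> {-pi..pi} - {-\<theta>..\<theta>}" for s
    using abs_k[of s] decr[of \<theta> "\<bar>s\<bar>"] that \<theta> by (auto simp: t_def)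
  have int_v: "set_integrable lebesgue {-pi..pi} v" and int_k: "set_integrable lebesgue {-\<theta>..\<theta>} k"
    using v k \<theta> by (auto intro!: absolutely_integrable_continuous_real elim: continuous_on_subset)
  have int_vp: "set_integrable lebesgue {-pi..pi} (\<lambda>s. max (v s - t) 0)"
    using v by (intro absolutely_integrable_continuous_real continuous_intros)
  have E_fin: "E \<in> lmeasurable" using E by (intro fmeasurableI) auto
  have E_meas: "measure lebesgue E = 2 * \<theta>" using E(3) \<theta> by (simp add: measure_def)
  have int_t: "set_integrable lebesgue E (\<lambda>s. t)"
    using E_fin by (simp add: absolutely_integrable_on_const)
  have int_vpE: "set_integrable lebesgue E (\<lambda>s. max (v s - t) 0)"
    using set_integrable_subset[OF int_vp E(1,2)] .
  have "(LINT s:E|lebesgue. v s) \<le> (LINT s:E|lebesgue. max (v s - t) 0 + t)"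
    using set_integrable_subset[OF int_v E(1,2)] int_vpE int_t
    by (intro set_integral_mono set_integral_add) auto
  also have "\<dots> = (LINT s:E|lebesgue. max (v s - t) 0) + 2 * \<theta> * t"
  proof -
    have "(LINT s:E|lebesgue. t) = 2 * \<theta> * t"
      using E_meas by (simp add: set_lebesgue_integral_def)
    then show ?thesis using set_integral_add(2)[OF int_vpE int_t] by simp
  qed
  also have "(LINT s:E|lebesgue. max (v s - t) 0) \<le> (LINT s:{-pi..pi}|lebesgue. max (v s - t) 0)"
    using int_vp int_vpE E(2) unfolding set_lebesgue_integral_def set_integrable_def
    by (intro integral_mono) (auto split: split_indicator)
  also have "\<dots> = integral {-pi..pi} (\<lambda>s. max (v s - t) 0)"
    by (rule set_lebesgue_integral_eq_integral(2)[OF int_vp])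
  also have "\<dots> \<le> integral {-pi..pi} (\<lambda>s. max (k s - t) 0)" by (rule le)
  also have "\<dots> = integral {-pi..pi} (\<lambda>s. if s \<in> {-\<theta>..\<theta>} then k s - t else 0)"
    using k_ge k_le by (intro integral_cong) (auto simp: max_def intro!: antisym)
  also have "\<dots> = integral {-\<theta>..\<theta>} (\<lambda>s. k s - t)"
    using \<theta> by (subst integral_restrict_Int) (simp add: Int_absorb2)
  \<comment> \<open>The term \<open>2 * \<theta> * t\<close> cancels the one from \<open>E\<close>,
    as \<open>E\<close> and the interval have equal measure.\<close>
  also have "\<dots> = integral {-\<theta>..\<theta>} k - 2 * \<theta> * t"
    using set_lebesgue_integral_eq_integral(1)[OF int_k] \<theta> by (subst integral_diff) auto
  also have "integral {-\<theta>..\<theta>} k = (LINT s:{-\<theta>..\<theta>}|lebesgue. k s)"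
    by (rule set_lebesgue_integral_eq_integral(2)[OF int_k, symmetric])
  finally show ?thesis by simp
qed

section \<open>Assembly for the class \<open>convC\<close>\<close>

theorem theorem3:
  fixes \<Omega> :: "complex set" and \<phi> :: "complex \<Rightarrow> complex"
  assumes "open \<Omega>" and "connected \<Omega>" and "simply_connected \<Omega>"
    and "\<Omega> \<noteq> UNIV" and "1 \<in> \<Omega>"
    and "\<forall>w \<in> \<Omega>. closed_segment 1 w \<subseteq> \<Omega>"
    and "cnj ` \<Omega> = \<Omega>"
    and "\<phi> holomorphic_on ball 0 1" and "inj_on \<phi> (ball 0 1)"
    and "\<phi> ` ball 0 1 = \<Omega>" and "\<phi> 0 = 1"
    and "Im (deriv \<phi> 0) = 0" and "Re (deriv \<phi> 0) > 0"
  shows "(\<forall>r::real. 0 < r \<and> r < 1 \<longrightarrow>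
            (\<forall>\<theta>::real. -pi \<le> \<theta> \<and> \<theta> \<le> pi \<longrightarrow>
               ln (norm (deriv (kfun \<phi>) (of_real r * exp (\<i> * of_real (-\<theta>)))))
             = ln (norm (deriv (kfun \<phi>) (of_real r * exp (\<i> * of_real \<theta>))))) \<and>
            (\<forall>a b::real. 0 \<le> a \<and> a \<le> b \<and> b \<le> pi \<longrightarrow>
               ln (norm (deriv (kfun \<phi>) (of_real r * exp (\<i> * of_real b))))
             \<le> ln (norm (deriv (kfun \<phi>) (of_real r * exp (\<i> * of_real a))))))
       \<and> (\<forall>f \<in> convC \<Omega>. \<forall>r::real. \<forall>\<Phi> :: real \<Rightarrow> real. \<forall>\<theta>::real. \<forall>E :: real set.
            0 < r \<and> r < 1 \<and> convex_on UNIV \<Phi> \<and> mono \<Phi> \<and> 0 \<le> \<theta> \<and> \<theta> \<le> pi \<and>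
            E \<in> sets lebesgue \<and> E \<subseteq> {-pi..pi} \<and> emeasure lebesgue E = ennreal (2 * \<theta>)
            \<longrightarrow>
            (LINT s:E|lebesgue. \<Phi> (ln (norm (deriv f (of_real r * exp (\<i> * of_real s))))))
              \<le> (LINT s:{-\<theta>..\<theta>}|lebesgue.
                    \<Phi> (ln (norm (deriv (kfun \<phi>) (of_real r * exp (\<i> * of_real s))))))
            \<and> (LINT s:E|lebesgue. r * norm (deriv f (of_real r * exp (\<i> * of_real s))))
              \<le> (LINT s:{-\<theta>..\<theta>}|lebesgue.
                    r * norm (deriv (kfun \<phi>) (of_real r * exp (\<i> * of_real s)))))"
proof -
  let ?c = "\<lambda>r s::real. of_real r * exp (\<i> * of_real s) :: complex"
  define h where "h z = \<phi> z - 1" for z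
  have h: "h holomorphic_on ball 0 1" "inj_on h (ball 0 1)" "h 0 = 0"
    unfolding h_def using assms(8,9,11) by (auto intro!: holomorphic_intros simp: inj_on_def)
  have h_img: "w \<in> h ` ball 0 1 \<longleftrightarrow> 1 + w \<in> \<Omega>" for w
    unfolding assms(10)[symmetric] by (auto simp: h_def image_iff eq_diff_eq add.commute)
  have "(\<phi> has_field_derivative deriv \<phi> 0) (at 0)"
    using holomorphic_derivI[OF assms(8) open_ball, of 0] by simp
  then have dh: "deriv h 0 = deriv \<phi> 0"
    unfolding h_def[abs_def] by (intro DERIV_imp_deriv) (auto intro!: derivative_eq_intros)
  have star: "starlike_univalent h"
    unfolding starlike_univalent_def
  proof (intro conjI allI impI h)
    fix z :: complex and t :: real assume z: "norm z < 1" and t: "0 \<le> t" "t \<le> 1"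
    have "1 + h z \<in> \<Omega>" using h_img[of "h z"] z by auto
    then have "closed_segment 1 (1 + h z) \<subseteq> \<Omega>" using assms(6) by blast
    moreover have "1 + of_real t * h z \<in> closed_segment 1 (1 + h z)"
      unfolding closed_segment_def using t
      by (auto intro!: exI[of _ t] simp: scaleR_conv_of_real algebra_simps)
    ultimately show "of_real t * h z \<in> h ` ball 0 1" using h_img by blast
  qed
  have "1 + cnj w \<in> \<Omega>" if "1 + w \<in> \<Omega>" for w
    using that assms(7) by (metis complex_cnj_add complex_cnj_one imageI)
  then have "cnj ` h ` ball 0 1 \<subseteq> h ` ball 0 1" "h ` ball 0 1 \<subseteq> cnj ` h ` ball 0 1"
    using h_img by (metis image_subsetI, metis subsetI complex_cnj_cnj imageI)
  then have sym_img: "cnj ` h ` ball 0 1 = h ` ball 0 1" by (rule antisym)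
  have sym: "h (cnj z) = cnj (h z)" if "norm z < 1" for z
    by (rule univalent_real_symmetric[OF h sym_img _ that]) (simp add: dh assms(12))
  have pos: "Im (h z) > 0" if "norm z < 1" "Im z > 0" for z
    by (rule univalent_real_symmetric_Im_pos[OF h sym _ that]) (simp_all add: dh assms(13))
  have nonneg: "Im (h z) \<ge> 0" if "norm z < 1" "Im z \<ge> 0" for z
  proof (cases "Im z = 0")
    case True
    then have "cnj z = z" by (simp add: complex_eq_iff)
    then have "h z = cnj (h z)" using sym[OF that(1)] by simp
    then show ?thesis by (simp add: complex_eq_iff)
  next
    case False
    then show ?thesis using pos[OF that(1)] that(2) by simp
  qed
  obtain D g where D: "D holomorphic_on ball 0 1" "\<And>z. h z = z * D z" and g0: "g 0 = 0"
    and "\<And>z. z \<in> ball 0 1 \<Longrightarrow> (g has_field_derivative D z) (at z)"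
    using primitive_of_quotient[OF h(1,3)] by metis
  then have g: "(g has_field_derivative D z) (at z)" if "norm z < 1" for z using that by simp
  have g_hol: "g holomorphic_on ball 0 1" using g by (auto simp: holomorphic_on_open intro!: exI)
  have deriv_k: "deriv (kfun \<phi>) z = exp (g z)" if "norm z < 1" for z
    by (rule deriv_kfun[OF g g0 _ that]) (simp_all add: D(2)[symmetric] h_def)
  have c: "norm (?c r s) < 1" if "0 < r" "r < 1" for r s
    using that by (simp add: norm_mult)
  have du: "((\<lambda>s. Re (g (?c r s))) has_real_derivative - Im (h (?c r s))) (at s)" if "0 < r" "r < 1" for r s
    using Re_along_circle_has_derivative[OF g[OF c[OF that]]] by (simp add: D(2))
  \<comment> \<open>Reflection reverses the sign of \<open>Im h\<close>, so both sides have the same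
    derivative in \<open>s\<close>; they agree at \<open>s = 0\<close>.\<close>
  have even: "Re (g (?c r (- s))) = Re (g (?c r s))" if r: "0 < r" "r < 1" for r s
  proof -
    have "((\<lambda>s. Re (g (?c r (- s))) - Re (g (?c r s))) has_real_derivative 0) (at x)" for x
    proof -
      have "?c r (- x) = cnj (?c r x)" by (simp add: exp_cnj)
      then have "Im (h (?c r (- x))) = - Im (h (?c r x))" using sym[OF c[OF r]] by (simp only: cnj.sel(2))
      then have "((\<lambda>s. Re (g (?c r (- s)))) has_real_derivative - Im (h (?c r x))) (at x)"
        using DERIV_mirror[of "\<lambda>s. Re (g (?c r s))" _ x] du[OF r, of "- x"] by simp
      from DERIV_diff[OF this du[OF r, of x]] show ?thesis by simp
    qed
    then have "Re (g (?c r (- s))) - Re (g (?c r s)) = Re (g (?c r (- 0))) - Re (g (?c r 0))"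
      by (intro DERIV_isconst_all) auto
    then show ?thesis by simp
  qed
  have decr: "Re (g (?c r b)) \<le> Re (g (?c r a))" if r: "0 < r" "r < 1" and ab: "0 \<le> a" "a \<le> b" "b \<le> pi" for r a b
  proof (rule DERIV_nonpos_imp_nonincreasing[OF ab(2)])
    fix x assume x: "a \<le> x" "x \<le> b"
    have "Im (?c r x) \<ge> 0" using x ab r sin_ge_zero[of x] by (simp add: Im_exp)
    then show "\<exists>y. ((\<lambda>s. Re (g (?c r s))) has_real_derivative y) (at x) \<and> y \<le> 0"
      using du[OF r, of x] nonneg[OF c[OF r]] by (intro exI conjI) auto
  qed
  have ln_k: "ln (norm (deriv (kfun \<phi>) (?c r s))) = Re (g (?c r s))" if "0 < r" "r < 1" for r s
    using deriv_k[OF c[OF that]] by simp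
  have main: "(LINT s:E|lebesgue. \<Phi> (ln (norm (deriv f (?c r s)))))
      \<le> (LINT s:{-\<theta>..\<theta>}|lebesgue. \<Phi> (ln (norm (deriv (kfun \<phi>) (?c r s)))))"
    if f: "f \<in> convC \<Omega>" and r: "0 < r" "r < 1" and \<Phi>: "convex_on UNIV \<Phi>" "mono \<Phi>"
      and \<theta>: "0 \<le> \<theta>" "\<theta> \<le> pi"
      and E: "E \<in> sets lebesgue" "E \<subseteq> {-pi..pi}" "emeasure lebesgue E = ennreal (2 * \<theta>)"
    for f r \<Phi> \<theta> E
  proof -
    have f': "f holomorphic_on ball 0 1" "deriv f 0 = 1" "\<And>z. norm z < 1 \<Longrightarrow> deriv f z \<noteq> 0"
      "\<And>z. norm z < 1 \<Longrightarrow> 1 + z * deriv (deriv f) z / deriv f z \<in> \<Omega>"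
      using f by (auto simp: convC_def A0_def)
    have df: "deriv f holomorphic_on ball 0 1" by (rule holomorphic_deriv[OF f'(1) open_ball])
    obtain Q0 where Q0: "Q0 holomorphic_on ball 0 1" "\<And>z. z \<in> ball 0 1 \<Longrightarrow> deriv f z = exp (Q0 z)"
      using contractible_imp_holomorphic_log[OF df convex_imp_contractible[OF convex_ball]] f'(3)
      by (metis mem_ball_0)
    \<comment> \<open>Since \<open>exp (Q0 0) = deriv f 0 = 1\<close>, subtracting
      \<open>Q0 0\<close> normalises the logarithm at 0 and leaves its exponential equal to
      \<open>deriv f\<close>.\<close>
    define Q where "Q z = Q0 z - Q0 0" for z
    have Q_hol: "Q holomorphic_on ball 0 1" unfolding Q_def by (intro holomorphic_intros Q0)
    have f_exp: "deriv f z = exp (Q z)" if "norm z < 1" for z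
      using Q0(2)[of z] Q0(2)[of 0] f'(2) that by (simp add: Q_def exp_diff)
    have dQ: "(Q has_field_derivative deriv Q z) (at z)" if "norm z < 1" for z
      using that by (intro holomorphic_derivI[OF Q_hol open_ball]) simp
    have "deriv (deriv f) z = exp (Q z) * deriv Q z" if z: "norm z < 1" for z
    proof (rule DERIV_imp_deriv, rule has_field_derivative_transform_within_open[where S = "ball 0 1"])
      show "((\<lambda>z. exp (Q z)) has_field_derivative exp (Q z) * deriv Q z) (at z)"
        by (rule DERIV_chain2[OF DERIV_exp dQ[OF z]])
    qed (use z f_exp in auto)
    \<comment> \<open>The logarithmic derivative \<open>f'' / f'\<close> is \<open>deriv Q\<close>,
      so membership of \<open>f\<close> in the class says that \<open>z * deriv Q z\<close> has
      values in the image of \<open>h\<close>.\<close>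
    then have q_img: "1 + z * deriv Q z \<in> \<Omega>" if "norm z < 1" for z
      using f'(4)[OF that] that f_exp[OF that] by simp
    have q_hol: "(\<lambda>z. z * deriv Q z) holomorphic_on ball 0 1"
      by (intro holomorphic_intros holomorphic_deriv[OF Q_hol]) auto
    have q_sub: "(\<lambda>z. z * deriv Q z) ` ball 0 1 \<subseteq> h ` ball 0 1"
      using q_img h_img by (intro image_subsetI) simp
    have "Q 0 = 0" by (simp add: Q_def)
    then obtain \<omega> where \<omega>: "\<omega> holomorphic_on ball 0 1" "\<omega> 0 = 0" "\<And>z. norm z < 1 \<Longrightarrow> norm (\<omega> z) \<le> norm z"
      "\<And>z. norm z < 1 \<Longrightarrow> g (\<omega> z) = Q z"
      using starlike_primitive_subordination[OF star D g g0 q_hol q_sub refl dQ] by metis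
    have ln_f: "ln (norm (deriv f (?c r s))) = Re (g (\<omega> (?c r s)))" for s
      using f_exp[OF c[OF r]] \<omega>(4)[OF c[OF r]] by simp
    have g\<omega>_hol: "(\<lambda>z. g (\<omega> z)) holomorphic_on ball 0 1"
      using Q_hol by (rule holomorphic_transform) (simp add: \<omega>(4))
    have cont: "continuous_on S (\<lambda>s. \<Phi> (Re (F (?c r s))))" if "F holomorphic_on ball 0 1" for F S
      by (rule continuous_on_compose2[OF convex_on_continuous[OF open_UNIV \<Phi>(1)]],
          intro continuous_intros continuous_on_circle_compose holomorphic_on_imp_continuous_on[OF that])
         (use r in auto)
    have "(LINT s:E|lebesgue. \<Phi> (Re (g (\<omega> (?c r s))))) \<le> (LINT s:{-\<theta>..\<theta>}|lebesgue. \<Phi> (Re (g (?c r s))))"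
    proof (rule set_integral_le_symmetric_decreasing[OF cont[OF g\<omega>_hol] cont[OF g_hol] _ _ _ \<theta> E])
      show "\<Phi> (Re (g (?c r b))) \<le> \<Phi> (Re (g (?c r a)))" if "0 \<le> a" "a \<le> b" "b \<le> pi" for a b
        using decr[OF r that] \<Phi>(2) by (rule monoD[rotated])
      show "integral {-pi..pi} (\<lambda>s. max (\<Phi> (Re (g (\<omega> (?c r s)))) - t) 0)
          \<le> integral {-pi..pi} (\<lambda>s. max (\<Phi> (Re (g (?c r s))) - t) 0)" for t
        by (rule Littlewood_subordination_convex[OF g_hol \<omega>(1-3) convex_on_positive_part[OF \<Phi>(1)]])
           (use r in auto)
    qed (use even[OF r] in auto)
    then show ?thesis by (simp only: ln_f ln_k[OF r])
  qed
  have length: "(LINT s:E|lebesgue. r * norm (deriv f (?c r s)))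
      \<le> (LINT s:{-\<theta>..\<theta>}|lebesgue. r * norm (deriv (kfun \<phi>) (?c r s)))"
    if f: "f \<in> convC \<Omega>" and r: "0 < r" "r < 1" and \<theta>: "0 \<le> \<theta>" "\<theta> \<le> pi"
      and E: "E \<in> sets lebesgue" "E \<subseteq> {-pi..pi}" "emeasure lebesgue E = ennreal (2 * \<theta>)"
    for f r \<theta> E
  proof -
    \<comment> \<open>With this choice of \<Phi>, the logarithm cancels wherever the derivatives are
      nonzero, leaving \<open>r\<close> times their modulus.\<close>
    have "convex_on UNIV (\<lambda>x. r * exp x)" "mono (\<lambda>x. r * exp x)"
      using r by (auto intro!: convex_on_cmul exp_convex monoI)
    note main[OF f r this \<theta> E]
    moreover have "deriv f (?c r s) \<noteq> 0" for s using f c[OF r] by (auto simp: convC_def)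
    moreover have "deriv (kfun \<phi>) (?c r s) \<noteq> 0" for s using deriv_k[OF c[OF r]] by simp
    ultimately show ?thesis by simp
  qed
  show ?thesis
  proof (intro conjI allI impI ballI; (elim conjE)?)
    fix r \<theta> :: real assume "0 < r" "r < 1"
    then show "ln (norm (deriv (kfun \<phi>) (?c r (- \<theta>)))) = ln (norm (deriv (kfun \<phi>) (?c r \<theta>)))"
      using even by (simp only: ln_k)
  next
    fix r a b :: real assume "0 < r" "r < 1" "0 \<le> a" "a \<le> b" "b \<le> pi"
    then show "ln (norm (deriv (kfun \<phi>) (?c r b))) \<le> ln (norm (deriv (kfun \<phi>) (?c r a)))"
      using decr by (simp only: ln_k)
  next
    fix f and r :: real and \<Phi> :: "real \<Rightarrow> real" and \<theta> E
    assume "f \<in> convC \<Omega>" "0 < r" "r < 1" "convex_on UNIV \<Phi>" "mono \<Phi>" "0 \<le> \<theta>" "\<theta> \<le> pi"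
      "E \<in> sets lebesgue" "E \<subseteq> {-pi..pi}" "emeasure lebesgue E = ennreal (2 * \<theta>)"
    note prems = this
    show "(LINT s:E|lebesgue. \<Phi> (ln (norm (deriv f (?c r s)))))
      \<le> (LINT s:{-\<theta>..\<theta>}|lebesgue. \<Phi> (ln (norm (deriv (kfun \<phi>) (?c r s)))))"
      by (rule main[OF prems])
    show "(LINT s:E|lebesgue. r * norm (deriv f (?c r s)))
      \<le> (LINT s:{-\<theta>..\<theta>}|lebesgue. r * norm (deriv (kfun \<phi>) (?c r s)))"
      by (rule length[OF prems(1-3,6-)])
  qed
qed

end
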